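(* Let $(X,\|\cdot\|)$ be a complex normed vector space and let $\langle\cdot\mid\cdot\rangle$ be the associated product defined in the context. For all $\vec{x},\vec{y}\in X$ and all real numbers $r$: (a) $\langle\vec{x}\mid\vec{y}\rangle=\overline{\langle\vec{y}\mid\vec{x}\rangle}$; (b) $\langle\vec{x}\mid\vec{x}\rangle$ is real with $\langle\vec{x}\mid\vec{x}\rangle\ge 0$, and $\langle\vec{x}\mid\vec{x}\rangle=0$ only for $\vec{x}=\vec{0}$; (c) $\langle r\vec{x}\mid\vec{y}\rangle=r\,\langle\vec{x}\mid\vec{y}\rangle=\langle\vec{x}\mid r\vec{y}\rangle$; (d) $\langle r\mathbf{i}\,\vec{x}\mid\vec{y}\rangle=r\mathbf{i}\,\langle\vec{x}\mid\vec{y}\rangle=\langle\vec{x}\mid -r\mathbf{i}\,\vec{y}\rangle$; (e) $\|\vec{x}\|=\sqrt{\langle\vec{x}\mid\vec{x}\rangle}$.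
   Context: For a complex normed vector space $(X,\|\cdot\|)$, with $\mathbf{i}$ the imaginary unit, the associated product $\langle\cdot\mid\cdot\rangle: X\times X\to\mathbb{C}$ is defined as follows. If $\vec{x}=\vec{0}$ or $\vec{y}=\vec{0}$, set $\langle\vec{x}\mid\vec{y}\rangle:=0$. If $\vec{x},\vec{y}\neq\vec{0}$, set $$\langle\vec{x}\mid\vec{y}\rangle := \|\vec{x}\|\,\|\vec{y}\|\cdot\frac14\left[\left\|\frac{\vec{x}}{\|\vec{x}\|}+\frac{\vec{y}}{\|\vec{y}\|}\right\|^2-\left\|\frac{\vec{x}}{\|\vec{x}\|}-\frac{\vec{y}}{\|\vec{y}\|}\right\|^2+\mathbf{i}\left(\left\|\frac{\vec{x}}{\|\vec{x}\|}+\mathbf{i}\frac{\vec{y}}{\|\vec{y}\|}\right\|^2-\left\|\frac{\vec{x}}{\|\vec{x}\|}-\mathbf{i}\frac{\vec{y}}{\|\vec{y}\|}\right\|^2\right)\right].$$ The norm is not assumed to come from an inner product. *)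

theory Defs
  imports Complex_Main
begin

text \<open>
  A complex normed vector space is a real normed vector space in which scalar multiplication
  is extended to the complex numbers. Nothing is lost by building on
  \<^class>\<open>real_normed_vector\<close>: restricting scalars makes every complex normed vector space one,
  and its metric and topology components are determined by the norm.
\<close>

class complex_normed_vector = real_normed_vector +
  fixes scaleC :: "complex \<Rightarrow> 'a \<Rightarrow> 'a"  (infixr \<open>*\<^sub>C\<close> 75)
  assumes scaleC_add_right: "a *\<^sub>C (x + y) = a *\<^sub>C x + a *\<^sub>C y"
    and scaleC_add_left: "(a + b) *\<^sub>C x = a *\<^sub>C x + b *\<^sub>C x"
    and scaleC_scaleC: "a *\<^sub>C (b *\<^sub>C x) = (a * b) *\<^sub>C x"
    and scaleC_of_real: "complex_of_real r *\<^sub>C x = r *\<^sub>R x"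
    and norm_scaleC: "norm (a *\<^sub>C x) = cmod a * norm x"

lemma scaleC_one: "1 *\<^sub>C x = (x :: 'a::complex_normed_vector)"
  using scaleC_of_real[of 1 x] by simp

global_interpretation complex_vector_space:
  vector_space "scaleC :: complex \<Rightarrow> 'a \<Rightarrow> 'a::complex_normed_vector"
  by unfold_locales (fact scaleC_add_right scaleC_add_left scaleC_scaleC scaleC_one)+

instantiation complex :: complex_normed_vector
begin

definition scaleC_complex :: "complex \<Rightarrow> complex \<Rightarrow> complex"
  where "scaleC_complex a x = a * x"

instance
  by standard
    (simp_all add: scaleC_complex_def algebra_simps norm_mult scaleR_conv_of_real)

end

definition assoc_prod :: "'a::complex_normed_vector \<Rightarrow> 'a \<Rightarrow> complex"  (\<open>\<langle>_ | _\<rangle>\<close>)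
  where "\<langle>x | y\<rangle> =
    (if x = 0 \<or> y = 0 then 0
     else
       let u = x /\<^sub>R norm x; v = y /\<^sub>R norm y in
       complex_of_real (norm x) * complex_of_real (norm y) * (1 / 4) *
         (complex_of_real ((norm (u + v))\<^sup>2 - (norm (u - v))\<^sup>2)
          + \<i> * complex_of_real ((norm (u + \<i> *\<^sub>C v))\<^sup>2 - (norm (u - \<i> *\<^sub>C v))\<^sup>2)))"

end

theory Submission imports Defs begin

text \<open>
  Up to the factor \<open>norm x * norm y\<close>, the product is the classical polarization expression
  evaluated at the directions \<^term>\<open>sgn x\<close> and \<^term>\<open>sgn y\<close>. Without the parallelogram law
  that expression need not be additive, but it keeps every symmetry that, up to multiplication by
  a power of \<open>\<i>\<close> (an isometry), only permutes the four points \<open>u + c *\<^sub>C v\<close> with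
  \<open>c \<in> {1, -1, \<i>, -\<i>}\<close>: swapping \<open>u\<close> and \<open>v\<close>
  conjugates it (lemma \<open>polarization_commute\<close>), while multiplying \<open>u\<close> by \<open>-1\<close> or by \<open>\<i>\<close>
  multiplies it by that scalar (\<open>polarization_minus\<close>, \<open>polarization_i\<close>).

  Normalizing first turns this into real homogeneity. Scaling \<open>x\<close> by a real \<open>r\<close> changes its
  direction only by the factor \<open>sgn r\<close>, and its norm by \<open>\<bar>r\<bar>\<close>; the two combine to
  \<open>\<bar>r\<bar> * sgn r = r\<close>. Everything in the second argument follows from the first by conjugate
  symmetry. On the diagonal, the imaginary part vanishes because \<open>1 + \<i>\<close> and \<open>1 - \<i>\<close> have
  equal modulus, and the real part is \<open>(norm x)\<^sup>2\<close>.
\<close>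

definition polarization :: "'a::complex_normed_vector \<Rightarrow> 'a \<Rightarrow> complex"
  where "polarization u v = Complex
    (((norm (u + v))\<^sup>2 - (norm (u - v))\<^sup>2) / 4)
    (((norm (u + \<i> *\<^sub>C v))\<^sup>2 - (norm (u - \<i> *\<^sub>C v))\<^sup>2) / 4)"

text \<open>
  The zero cases in the definition of the product agree with the general formula, since
  \<open>sgn 0 = 0\<close> and \<open>norm 0 = 0\<close>; so none of the
  symmetries below has to treat vanishing arguments separately.
\<close>
lemma assoc_prod_eq_polarization_sgn:
  "\<langle>x | y\<rangle> = of_real (norm x * norm y) * polarization (sgn x) (sgn y)"
  by (simp add: assoc_prod_def polarization_def sgn_div_norm Let_def complex_eq_iff field_simps)

text \<open>
  Multiplication by \<open>\<i>\<close> is an isometry, so it may be moved from one summand to the other at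
  the price of a sign: \<open>\<i> * (u - \<i> v) = \<i> u + v\<close>, and likewise for the other sign.
\<close>
lemma norm_i_scaleC_add:
  fixes u v :: "'a::complex_normed_vector"
  shows "norm (\<i> *\<^sub>C u + v) = norm (u - \<i> *\<^sub>C v)"
proof -
  have "\<i> *\<^sub>C u + v = \<i> *\<^sub>C (u - \<i> *\<^sub>C v)"
    by (simp add: complex_vector_space.scale_right_diff_distrib scaleC_scaleC)
  then show ?thesis
    by (simp add: norm_scaleC)
qed

lemma norm_i_scaleC_diff:
  fixes u v :: "'a::complex_normed_vector"
  shows "norm (\<i> *\<^sub>C u - v) = norm (u + \<i> *\<^sub>C v)"
  using norm_i_scaleC_add[of u "- v"] by simp

lemma polarization_commute: "polarization v u = cnj (polarization u v)"
proof -
  have "norm (v + \<i> *\<^sub>C u) = norm (u - \<i> *\<^sub>C v)"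
    by (subst add.commute) (rule norm_i_scaleC_add)
  moreover have "norm (v - \<i> *\<^sub>C u) = norm (u + \<i> *\<^sub>C v)"
    by (subst norm_minus_commute) (rule norm_i_scaleC_diff)
  moreover have "norm (v + u) = norm (u + v)" "norm (v - u) = norm (u - v)"
    by (simp_all only: add.commute norm_minus_commute)
  ultimately show ?thesis
    by (simp add: polarization_def complex_eq_iff diff_divide_distrib)
qed

lemma polarization_minus:
  fixes u v :: "'a::complex_normed_vector"
  shows "polarization (- u) v = - polarization u v"
proof -
  have "norm (- u + w) = norm (u - w)" "norm (- u - w) = norm (u + w)" for w :: 'a
    by (metis add_uminus_conv_diff minus_diff_eq norm_minus_cancel uminus_add_conv_diff,
        metis minus_add_distrib diff_conv_add_uminus norm_minus_cancel)
  then show ?thesis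
    by (simp add: polarization_def complex_eq_iff field_simps)
qed

lemma polarization_zero: "polarization 0 v = 0"
  by (simp add: polarization_def complex_eq_iff)

lemma polarization_i: "polarization (\<i> *\<^sub>C u) v = \<i> * polarization u v"
proof -
  have "norm (\<i> *\<^sub>C u + \<i> *\<^sub>C v) = norm (u + v)" "norm (\<i> *\<^sub>C u - \<i> *\<^sub>C v) = norm (u - v)"
    by (simp_all add: norm_scaleC flip: scaleC_add_right
        complex_vector_space.scale_right_diff_distrib)
  then show ?thesis
    by (simp add: polarization_def complex_eq_iff norm_i_scaleC_add norm_i_scaleC_diff
        diff_divide_distrib)
qed

lemma polarization_self: "polarization u u = of_real ((norm u)\<^sup>2)"
proof -
  have "norm (u + \<i> *\<^sub>C u) = norm (u - \<i> *\<^sub>C u)"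
    by (subst add.commute) (rule norm_i_scaleC_add)
  moreover have "norm (u + u) = 2 * norm u"
    by (simp flip: scaleR_2)
  ultimately show ?thesis
    by (simp add: polarization_def complex_eq_iff power_mult_distrib)
qed

lemma polarization_sgn_scaleR:
  "polarization (sgn r *\<^sub>R u) v = of_real (sgn r) * polarization u v"
  by (cases r "0 :: real" rule: linorder_cases)
    (simp_all add: polarization_minus polarization_zero)

lemma assoc_prod_commute: "\<langle>x | y\<rangle> = cnj \<langle>y | x\<rangle>"
  using polarization_commute[of "sgn x" "sgn y"]
  by (simp add: assoc_prod_eq_polarization_sgn mult.commute)

lemma assoc_prod_self: "\<langle>x | x\<rangle> = of_real ((norm x)\<^sup>2)"
  by (simp add: assoc_prod_eq_polarization_sgn polarization_self norm_sgn power2_eq_square)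

lemma assoc_prod_scaleR_left: "\<langle>r *\<^sub>R x | y\<rangle> = of_real r * \<langle>x | y\<rangle>"
proof -
  \<comment> \<open>The absolute value comes from the norm factor, the sign from the direction of \<open>r *\<^sub>R x\<close>.\<close>
  have "\<langle>r *\<^sub>R x | y\<rangle> = of_real (\<bar>r\<bar> * sgn r) * \<langle>x | y\<rangle>"
    by (simp add: assoc_prod_eq_polarization_sgn sgn_scaleR polarization_sgn_scaleR mult_ac
        del: abs_mult_sgn)
  then show ?thesis
    by (simp add: abs_mult_sgn)
qed

lemma assoc_prod_i_left: "\<langle>\<i> *\<^sub>C x | y\<rangle> = \<i> * \<langle>x | y\<rangle>"
proof -
  have "sgn (\<i> *\<^sub>C x) = \<i> *\<^sub>C sgn x"
    by (simp add: sgn_div_norm norm_scaleC scaleC_scaleC mult.commute flip: scaleC_of_real)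
  then show ?thesis
    by (simp add: assoc_prod_eq_polarization_sgn polarization_i norm_scaleC)
qed

lemma assoc_prod_imaginary_left:
  "\<langle>(of_real r * \<i>) *\<^sub>C x | y\<rangle> = of_real r * \<i> * \<langle>x | y\<rangle>"
proof -
  have "(of_real r * \<i>) *\<^sub>C x = r *\<^sub>R (\<i> *\<^sub>C x)"
    by (simp add: scaleC_scaleC flip: scaleC_of_real)
  then show ?thesis
    by (simp add: assoc_prod_scaleR_left assoc_prod_i_left)
qed

lemma assoc_prod_scaleR_right: "\<langle>x | r *\<^sub>R y\<rangle> = of_real r * \<langle>x | y\<rangle>"
  by (metis assoc_prod_commute assoc_prod_scaleR_left complex_cnj_complex_of_real
      complex_cnj_mult)

text \<open>
  By conjugate symmetry the scalar of the second argument comes out conjugated; \<open>r * \<i>\<close> is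
  the conjugate of \<open>- (r * \<i>)\<close>.
\<close>
lemma assoc_prod_imaginary_right:
  "\<langle>x | (- (of_real r * \<i>)) *\<^sub>C y\<rangle> = of_real r * \<i> * \<langle>x | y\<rangle>"
proof -
  have "\<langle>x | (- (of_real r * \<i>)) *\<^sub>C y\<rangle> = cnj \<langle>(of_real (- r) * \<i>) *\<^sub>C y | x\<rangle>"
    using assoc_prod_commute by simp
  also have "\<dots> = of_real r * \<i> * cnj \<langle>y | x\<rangle>"
    unfolding assoc_prod_imaginary_left by simp
  finally show ?thesis
    using assoc_prod_commute[of x y] by simp
qed

theorem proposition2p1:
  fixes x y :: "'a::complex_normed_vector" and r :: real
  shows
    "\<langle>x | y\<rangle> = cnj \<langle>y | x\<rangle> \<and>
     (\<langle>x | x\<rangle> \<in> \<real> \<and> 0 \<le> Re \<langle>x | x\<rangle> \<and> (\<langle>x | x\<rangle> = 0 \<longrightarrow> x = 0)) \<and>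
     (\<langle>r *\<^sub>R x | y\<rangle> = complex_of_real r * \<langle>x | y\<rangle> \<and>
      complex_of_real r * \<langle>x | y\<rangle> = \<langle>x | r *\<^sub>R y\<rangle>) \<and>
     (\<langle>(complex_of_real r * \<i>) *\<^sub>C x | y\<rangle> = complex_of_real r * \<i> * \<langle>x | y\<rangle> \<and>
      complex_of_real r * \<i> * \<langle>x | y\<rangle> = \<langle>x | (- (complex_of_real r * \<i>)) *\<^sub>C y\<rangle>) \<and>
     norm x = sqrt (Re \<langle>x | x\<rangle>)"
  using assoc_prod_commute[of x y]
  by (simp add: assoc_prod_self assoc_prod_scaleR_left assoc_prod_scaleR_right
      assoc_prod_imaginary_left assoc_prod_imaginary_right del: complex_vector_space.scale_minus_left)

end
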